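(* Let $(X,\tau)$ be a fuzzy topological space. Then every fuzzy closed set in $X$ is fuzzy weakly-closed, and every fuzzy weakly-closed set in $X$ is fuzzy generalized closed.
   Context: Fuzzy topological spaces (FTS) are in Chang's sense: a fuzzy set in $X$ is a function $X\to[0,1]$, ordered pointwise by $\leq$, with $\vee,\wedge$ pointwise supremum and infimum and complement $A^c=1-A$; $0_X,1_X$ are the constant functions. A fuzzy topology $\tau$ on $X$ is a family of fuzzy sets containing $0_X,1_X$ and closed under finite $\wedge$ and arbitrary $\bigvee$; members of $\tau$ are fuzzy open and their complements fuzzy closed. $cl(A)$ is the infimum of all fuzzy closed sets $\geq A$ and $int(A)$ is the supremum of all fuzzy open sets $\leq A$. A fuzzy set $A$ is fuzzy semi-closed if $int(cl(A))\leq A$; a fuzzy set is fuzzy semi-open if its complement is fuzzy semi-closed. A fuzzy set $A$ is fuzzy weakly-closed if $cl(A)\leq U$ for every fuzzy semi-open set $U$ with $A\leq U$. A fuzzy set $A$ is fuzzy generalized closed (Fg-closed) if $cl(A)\leq U$ whenever $A\leq U$ and $U\in\tau$. *)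

theory Defs
  imports Complex_Main "HOL-Library.FuncSet"
begin

(* A fuzzy set in X is a function X \<rightarrow> [0,1], represented as an extensional function on the
   (possibly empty) carrier X, so that equality of fuzzy sets is equality in HOL. *)
definition fuzzy_sets :: "'a set \<Rightarrow> ('a \<Rightarrow> real) set" where
  "fuzzy_sets X = (X \<rightarrow>\<^sub>E {0..1})"

definition fuzzy_const :: "'a set \<Rightarrow> real \<Rightarrow> 'a \<Rightarrow> real" where
  "fuzzy_const X c = (\<lambda>x\<in>X. c)"

definition fuzzy_le :: "'a set \<Rightarrow> ('a \<Rightarrow> real) \<Rightarrow> ('a \<Rightarrow> real) \<Rightarrow> bool" where
  "fuzzy_le X A B \<longleftrightarrow> (\<forall>x\<in>X. A x \<le> B x)"

definition fuzzy_compl :: "'a set \<Rightarrow> ('a \<Rightarrow> real) \<Rightarrow> 'a \<Rightarrow> real" where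
  "fuzzy_compl X A = (\<lambda>x\<in>X. 1 - A x)"

(* Supremum and infimum are taken in the complete lattice [0,1]. Inserting its bottom (resp. top)
   element changes nothing for nonempty families of fuzzy sets and gives the value 0 (resp. 1)
   for the empty family, where Sup and Inf on the reals are unspecified. *)
definition fuzzy_Sup :: "'a set \<Rightarrow> ('a \<Rightarrow> real) set \<Rightarrow> 'a \<Rightarrow> real" where
  "fuzzy_Sup X F = (\<lambda>x\<in>X. Sup (insert 0 ((\<lambda>A. A x) ` F)))"

definition fuzzy_Inf :: "'a set \<Rightarrow> ('a \<Rightarrow> real) set \<Rightarrow> 'a \<Rightarrow> real" where
  "fuzzy_Inf X F = (\<lambda>x\<in>X. Inf (insert 1 ((\<lambda>A. A x) ` F)))"

definition fuzzy_topology :: "'a set \<Rightarrow> ('a \<Rightarrow> real) set \<Rightarrow> bool" where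
  "fuzzy_topology X \<tau> \<longleftrightarrow>
     \<tau> \<subseteq> fuzzy_sets X \<and>
     fuzzy_const X 0 \<in> \<tau> \<and> fuzzy_const X 1 \<in> \<tau> \<and>
     (\<forall>F. finite F \<and> F \<subseteq> \<tau> \<longrightarrow> fuzzy_Inf X F \<in> \<tau>) \<and>
     (\<forall>F. F \<subseteq> \<tau> \<longrightarrow> fuzzy_Sup X F \<in> \<tau>)"

definition fuzzy_closed :: "'a set \<Rightarrow> ('a \<Rightarrow> real) set \<Rightarrow> ('a \<Rightarrow> real) \<Rightarrow> bool" where
  "fuzzy_closed X \<tau> A \<longleftrightarrow> (\<exists>B\<in>\<tau>. A = fuzzy_compl X B)"

definition fuzzy_cl :: "'a set \<Rightarrow> ('a \<Rightarrow> real) set \<Rightarrow> ('a \<Rightarrow> real) \<Rightarrow> 'a \<Rightarrow> real" where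
  "fuzzy_cl X \<tau> A = fuzzy_Inf X {C. fuzzy_closed X \<tau> C \<and> fuzzy_le X A C}"

definition fuzzy_int :: "'a set \<Rightarrow> ('a \<Rightarrow> real) set \<Rightarrow> ('a \<Rightarrow> real) \<Rightarrow> 'a \<Rightarrow> real" where
  "fuzzy_int X \<tau> A = fuzzy_Sup X {U \<in> \<tau>. fuzzy_le X U A}"

definition fuzzy_semi_closed :: "'a set \<Rightarrow> ('a \<Rightarrow> real) set \<Rightarrow> ('a \<Rightarrow> real) \<Rightarrow> bool" where
  "fuzzy_semi_closed X \<tau> A \<longleftrightarrow>
     A \<in> fuzzy_sets X \<and> fuzzy_le X (fuzzy_int X \<tau> (fuzzy_cl X \<tau> A)) A"

definition fuzzy_semi_open :: "'a set \<Rightarrow> ('a \<Rightarrow> real) set \<Rightarrow> ('a \<Rightarrow> real) \<Rightarrow> bool" where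
  "fuzzy_semi_open X \<tau> A \<longleftrightarrow> A \<in> fuzzy_sets X \<and> fuzzy_semi_closed X \<tau> (fuzzy_compl X A)"

definition fuzzy_weakly_closed :: "'a set \<Rightarrow> ('a \<Rightarrow> real) set \<Rightarrow> ('a \<Rightarrow> real) \<Rightarrow> bool" where
  "fuzzy_weakly_closed X \<tau> A \<longleftrightarrow>
     A \<in> fuzzy_sets X \<and>
     (\<forall>U. fuzzy_semi_open X \<tau> U \<and> fuzzy_le X A U \<longrightarrow> fuzzy_le X (fuzzy_cl X \<tau> A) U)"

definition fuzzy_generalized_closed :: "'a set \<Rightarrow> ('a \<Rightarrow> real) set \<Rightarrow> ('a \<Rightarrow> real) \<Rightarrow> bool" where
  "fuzzy_generalized_closed X \<tau> A \<longleftrightarrow>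
     A \<in> fuzzy_sets X \<and>
     (\<forall>U. U \<in> \<tau> \<and> fuzzy_le X A U \<longrightarrow> fuzzy_le X (fuzzy_cl X \<tau> A) U)"

end

theory Submission
  imports Defs
begin

text \<open>A closed \<open>A\<close> is one of the closed sets whose infimum is its closure, so
  cl(A) \<le> A (\<open>fuzzy_cl_least\<close>), and every U above A is above cl(A); hence closed
  sets are weakly-closed. For the second implication it is enough that open sets are semi-open,
  since weak closedness then tests against at least the sets U that generalized closedness uses.
  Passing to complements, this says that closed sets C are semi-closed, which follows from
  int(cl(C)) \<le> cl(C) \<le> C.\<close>

lemma fuzzy_compl_in_fuzzy_sets:
  assumes "A \<in> fuzzy_sets X"
  shows "fuzzy_compl X A \<in> fuzzy_sets X"
  using assms by (auto simp: fuzzy_sets_def fuzzy_compl_def PiE_iff)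

lemma fuzzy_closed_in_fuzzy_sets:
  assumes "\<tau> \<subseteq> fuzzy_sets X" "fuzzy_closed X \<tau> C"
  shows "C \<in> fuzzy_sets X"
  using assms fuzzy_compl_in_fuzzy_sets unfolding fuzzy_closed_def by blast

lemma fuzzy_le_trans: "fuzzy_le X A B \<Longrightarrow> fuzzy_le X B C \<Longrightarrow> fuzzy_le X A C"
  unfolding fuzzy_le_def by (meson order_trans)

lemma fuzzy_cl_least:
  assumes "\<tau> \<subseteq> fuzzy_sets X" "fuzzy_closed X \<tau> C" "fuzzy_le X A C"
  shows "fuzzy_le X (fuzzy_cl X \<tau> A) C"
  unfolding fuzzy_le_def
proof
  fix x assume x: "x \<in> X"
  let ?F = "{C. fuzzy_closed X \<tau> C \<and> fuzzy_le X A C}"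
  \<comment> \<open>The reals are only conditionally complete, so \<open>cInf_lower\<close> requires
    a lower bound; 0 serves because closed sets take values in [0,1].\<close>
  have "0 \<le> D x" if "D \<in> ?F" for D
    using that fuzzy_closed_in_fuzzy_sets[OF assms(1)] x
    by (auto simp: fuzzy_sets_def PiE_iff)
  then have "bdd_below (insert 1 ((\<lambda>D. D x) ` ?F))"
    by (intro bdd_belowI[of _ 0]) auto
  then have "Inf (insert 1 ((\<lambda>D. D x) ` ?F)) \<le> C x"
    using assms(2,3) by (intro cInf_lower) auto
  then show "fuzzy_cl X \<tau> A x \<le> C x"
    using x by (simp add: fuzzy_cl_def fuzzy_Inf_def)
qed

text \<open>Combines int(A) \<le> A with A \<le> B, for use with A = cl(C) and B = C.\<close>

lemma fuzzy_int_le: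
  assumes "fuzzy_le X A B" "B \<in> fuzzy_sets X"
  shows "fuzzy_le X (fuzzy_int X \<tau> A) B"
  unfolding fuzzy_le_def
proof
  fix x assume x: "x \<in> X"
  have "Sup (insert 0 ((\<lambda>U. U x) ` {U \<in> \<tau>. fuzzy_le X U A})) \<le> B x"
  proof (rule cSup_least)
    fix y assume "y \<in> insert 0 ((\<lambda>U. U x) ` {U \<in> \<tau>. fuzzy_le X U A})"
    then consider "y = 0" | U where "y = U x" "fuzzy_le X U A" by blast
    then show "y \<le> B x"
    proof cases
      case 1
      \<comment> \<open>The 0 inserted into the supremum is no value of an open set below
        \<open>A\<close>; it is bounded because \<open>B\<close> is nonnegative.\<close>
      then show ?thesis using assms(2) x by (auto simp: fuzzy_sets_def PiE_iff)
    next
      case 2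
      then show ?thesis using fuzzy_le_trans[OF 2(2) assms(1)] x
        by (simp add: fuzzy_le_def)
    qed
  qed simp
  then show "fuzzy_int X \<tau> A x \<le> B x"
    using x by (simp add: fuzzy_int_def fuzzy_Sup_def)
qed

lemma fuzzy_closed_imp_semi_closed:
  assumes "\<tau> \<subseteq> fuzzy_sets X" "fuzzy_closed X \<tau> C"
  shows "fuzzy_semi_closed X \<tau> C"
proof -
  have C: "C \<in> fuzzy_sets X" using fuzzy_closed_in_fuzzy_sets assms .
  have "fuzzy_le X (fuzzy_cl X \<tau> C) C"
    using assms by (intro fuzzy_cl_least) (auto simp: fuzzy_le_def)
  then show ?thesis
    using C by (simp add: fuzzy_semi_closed_def fuzzy_int_le)
qed

text \<open>The complement of \<open>U\<close> is closed, with \<open>U\<close> itself as the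
  witness in \<open>fuzzy_closed\<close>, and therefore semi-closed.\<close>

lemma fuzzy_open_imp_semi_open:
  assumes "\<tau> \<subseteq> fuzzy_sets X" "U \<in> \<tau>"
  shows "fuzzy_semi_open X \<tau> U"
  using assms fuzzy_closed_imp_semi_closed[OF assms(1)]
  unfolding fuzzy_semi_open_def fuzzy_closed_def by blast

lemma fuzzy_closed_imp_weakly_closed:
  assumes "\<tau> \<subseteq> fuzzy_sets X" "fuzzy_closed X \<tau> A"
  shows "fuzzy_weakly_closed X \<tau> A"
proof -
  have "fuzzy_le X (fuzzy_cl X \<tau> A) A"
    using assms by (intro fuzzy_cl_least) (auto simp: fuzzy_le_def)
  then show ?thesis
    using fuzzy_closed_in_fuzzy_sets[OF assms] fuzzy_le_trans
    unfolding fuzzy_weakly_closed_def by blast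
qed

lemma fuzzy_weakly_closed_imp_generalized_closed:
  assumes "\<tau> \<subseteq> fuzzy_sets X" "fuzzy_weakly_closed X \<tau> A"
  shows "fuzzy_generalized_closed X \<tau> A"
  using assms fuzzy_open_imp_semi_open[OF assms(1)]
  unfolding fuzzy_weakly_closed_def fuzzy_generalized_closed_def by blast

theorem mainTheorem1:
  fixes X :: "'a set" and \<tau> :: "('a \<Rightarrow> real) set"
  assumes "fuzzy_topology X \<tau>"
  shows "(\<forall>A. fuzzy_closed X \<tau> A \<longrightarrow> fuzzy_weakly_closed X \<tau> A) \<and>
         (\<forall>A. fuzzy_weakly_closed X \<tau> A \<longrightarrow> fuzzy_generalized_closed X \<tau> A)"
proof -
  have "\<tau> \<subseteq> fuzzy_sets X" using assms by (simp add: fuzzy_topology_def)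
  then show ?thesis
    using fuzzy_closed_imp_weakly_closed fuzzy_weakly_closed_imp_generalized_closed by blast
qed

end
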